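(* Let $g:\mathbb{R}^n\to\mathbb{R}$ be $K$-Lipschitz with respect to $\|\cdot\|_2$, with decomposition $g(\mathbf{x})=\tilde g(\mathbf{x}^{(1)})+\boldsymbol\beta^T\mathbf{x}^{(2)}$, where $\mathbf{x}=(\mathbf{x}^{(1)},\mathbf{x}^{(2)})$, $\mathbf{x}^{(1)}\in\mathbb{R}^m$, $\mathbf{x}^{(2)}\in\mathbb{R}^{n-m}$, $m\le n$, $\boldsymbol\beta\in\mathbb{R}^{n-m}$, and $\tilde g:\mathbb{R}^m\to\mathbb{R}$ is Lipschitz continuous. Let $\mathbf{X}\in\mathcal{L}^p_n$ with $g(\mathbf{X})\in\mathcal{L}^p$. Let $Q$ be a positive-semi-definite diagonal $n\times n$ matrix with at least one non-zero entry, with smallest and largest eigenvalues $\lambda_{\min}\ge0$ and $\lambda_{\max}>0$. Then, for any $\epsilon\ge0$ and any law-invariant risk functional $\rho$, $$\sup_{Y\in\mathfrak{B}_{\lambda_{\max}x^2,\|\boldsymbol\beta\|_2^2\epsilon}(g(\mathbf{X}))}\rho(Y)\le\sup_{\mathbf{Y}\in\mathfrak{B}^n_{\mathbf{x}^TQ\mathbf{x},\epsilon}(\mathbf{X})}\rho\big(g(\mathbf{Y})\big)\le\sup_{Y\in\mathfrak{B}_{\lambda_{\min}x^2,K^2\epsilon}(g(\mathbf{X}))}\rho(Y).$$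
   Context: Fix $p\ge1$ and a non-atomic probability space $(\Omega,\mathcal{B},\mathbb{P})$ with $\mathcal{B}=\mathcal{B}(\mathbb{R}^n)$; all random variables/vectors live on it. $\mathcal{L}^p_n$ is the space of $n$-dimensional random vectors with $\mathbb{E}[\|\mathbf{X}\|^p]<\infty$, $\mathcal{L}^p=\mathcal{L}^p_1$. A Bregman generator is a convex (not necessarily strictly) differentiable function $\Phi$ on a convex domain of $\mathbb{R}^n$, with Bregman divergence $B_\Phi(\mathbf{z}_1,\mathbf{z}_2)=\Phi(\mathbf{z}_1)-\Phi(\mathbf{z}_2)-\nabla\Phi(\mathbf{z}_2)\cdot(\mathbf{z}_1-\mathbf{z}_2)$. The Bregman-Wasserstein divergence is $\mathcal{B}^n_\Phi[F,G]=\inf\mathbb{E}[B_\Phi(\mathbf{X},\mathbf{Y})]$ over all couplings with $F_{\mathbf{X}}=F$, $F_{\mathbf{Y}}=G$, and $\mathfrak{B}^n_{\Phi,\epsilon}(\mathbf{X})=\{\mathbf{Z}:\mathcal{B}^n_\Phi[F_{\mathbf{Z}},F_{\mathbf{X}}]\le\epsilon\}$ (superscript dropped for $n=1$). The subscript is the generator: $\Phi(\mathbf{x})=\mathbf{x}^TQ\mathbf{x}$ (divergence $(\mathbf{z}_1-\mathbf{z}_2)^TQ(\mathbf{z}_1-\mathbf{z}_2)$), respectively $\phi(x)=\lambda x^2$ (divergence $\lambda(z_1-z_2)^2$). It is tacitly assumed that BW uncertainty sets contain at least two elements. A risk functional $\rho$ is a real-valued functional on random variables (on $\mathcal{L}^p$,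 quantities involved assumed well defined); it is law invariant if $\rho(X)=\rho(Y)$ whenever $X,Y$ have the same distribution. Conventions on the decomposition: if $g$ has no linear components then $m=n$ and $\tilde g=g$ (so $\|\boldsymbol\beta\|_2=0$); otherwise the smallest possible $m$ is chosen. Standing assumption: $g$ is non-constant. *)

theory Defs
  imports "HOL-Probability.Probability"
begin

definition nonatomic :: "'w measure \<Rightarrow> bool" where
  "nonatomic M \<longleftrightarrow>
     (\<forall>A\<in>sets M. 0 < emeasure M A \<longrightarrow>
        (\<exists>B\<in>sets M. B \<subseteq> A \<and> 0 < emeasure M B \<and> emeasure M B < emeasure M A))"

text \<open>Elements are functions, not classes modulo almost sure equality. The type \<open>'a\<close> is
  instantiated with \<^typ>\<open>real\<close> for random variables and with \<open>real ^ 'n\<close> for random vectors.\<close>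

definition Lp_space :: "'w measure \<Rightarrow> real \<Rightarrow> ('w \<Rightarrow> 'a::euclidean_space) set" where
  "Lp_space M p = {X \<in> borel_measurable M. integrable M (\<lambda>w. norm (X w) powr p)}"

definition law_invariant :: "'w measure \<Rightarrow> real \<Rightarrow> (('w \<Rightarrow> real) \<Rightarrow> real) \<Rightarrow> bool" where
  "law_invariant M p \<rho> \<longleftrightarrow>
     (\<forall>X\<in>Lp_space M p. \<forall>Y\<in>Lp_space M p. distr M borel X = distr M borel Y \<longrightarrow> \<rho> X = \<rho> Y)"

definition gradient :: "('a::euclidean_space \<Rightarrow> real) \<Rightarrow> 'a \<Rightarrow> 'a" where
  "gradient \<Phi> z = (THE D. GDERIV \<Phi> z :> D)"

definition bregman_div :: "('a::euclidean_space \<Rightarrow> real) \<Rightarrow> 'a \<Rightarrow> 'a \<Rightarrow> real" where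
  "bregman_div \<Phi> z1 z2 = \<Phi> z1 - \<Phi> z2 - gradient \<Phi> z2 \<bullet> (z1 - z2)"

text \<open>Distributions are given by their laws, i.e. Borel measures. The divergence is meant for
  convex generators only: there \<^const>\<open>bregman_div\<close> is nonnegative, \<^const>\<open>ennreal\<close> truncates
  nothing, and the expectation is well defined, possibly infinite.\<close>

definition bregman_wasserstein ::
    "'w measure \<Rightarrow> ('a::euclidean_space \<Rightarrow> real) \<Rightarrow> 'a measure \<Rightarrow> 'a measure \<Rightarrow> ennreal" where
  "bregman_wasserstein M \<Phi> F G =
     (INF (X, Y) \<in> {(X, Y). X \<in> borel_measurable M \<and> Y \<in> borel_measurable M \<and>
                            distr M borel X = F \<and> distr M borel Y = G}.
        \<integral>\<^sup>+ w. ennreal (bregman_div \<Phi> (X w) (Y w)) \<partial>M)"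

text \<open>The set is a subset of \<open>L\<^sup>p\<close>, the domain on which risk functionals are considered.\<close>

definition bw_uncertainty_set ::
    "'w measure \<Rightarrow> real \<Rightarrow> ('a::euclidean_space \<Rightarrow> real) \<Rightarrow> real \<Rightarrow> ('w \<Rightarrow> 'a) \<Rightarrow> ('w \<Rightarrow> 'a) set" where
  "bw_uncertainty_set M p \<Phi> \<epsilon> X =
     {Z \<in> Lp_space M p.
        bregman_wasserstein M \<Phi> (distr M borel Z) (distr M borel X) \<le> ennreal \<epsilon>}"

definition eigenvalues :: "real ^ 'n ^ 'n \<Rightarrow> real set" where
  "eigenvalues A = {c. \<exists>v. v \<noteq> 0 \<and> A *v v = c *\<^sub>R v}"

definition diagonal_matrix :: "real ^ 'n ^ 'n \<Rightarrow> bool" where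
  "diagonal_matrix A \<longleftrightarrow> (\<forall>i j. i \<noteq> j \<longrightarrow> A $ i $ j = 0)"

definition positive_semidefinite :: "real ^ 'n ^ 'n \<Rightarrow> bool" where
  "positive_semidefinite A \<longleftrightarrow> transpose A = A \<and> (\<forall>x. 0 \<le> x \<bullet> (A *v x))"

text \<open>The splitting \<open>x = (x\<^sup>1, x\<^sup>2)\<close> with \<open>x\<^sup>1 \<in> \<real>\<^sup>m\<close> and \<open>x\<^sup>2 \<in> \<real>\<^sup>n\<^sup>-\<^sup>m\<close> is encoded by the set \<open>I\<close>
  of the \<open>m = card I\<close> coordinates that make up \<open>x\<^sup>1\<close>, where \<open>m = 0\<close> and \<open>m = n\<close> are possible. The
  spaces \<open>\<real>\<^sup>m\<close> and \<open>\<real>\<^sup>n\<^sup>-\<^sup>m\<close> are identified, isometrically, with the coordinate subspaces of \<open>I\<close>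
  and of \<open>- I\<close>, so that \<open>norm \<beta>\<close> is the Euclidean norm of the \<open>n - m\<close> coefficients.\<close>

definition coord_subspace :: "'n set \<Rightarrow> (real ^ 'n) set" where
  "coord_subspace I = {x. \<forall>i. i \<notin> I \<longrightarrow> x $ i = 0}"

definition coord_proj :: "'n set \<Rightarrow> real ^ 'n \<Rightarrow> real ^ 'n" where
  "coord_proj I x = (\<chi> i. if i \<in> I then x $ i else 0)"

text \<open>A function may have several such decompositions; no minimality of \<open>I\<close> is required.\<close>

definition has_decomposition ::
    "(real ^ 'n \<Rightarrow> real) \<Rightarrow> 'n set \<Rightarrow> (real ^ 'n \<Rightarrow> real) \<Rightarrow> real ^ 'n \<Rightarrow> bool" where
  "has_decomposition g I gt \<beta> \<longleftrightarrow>
     (\<exists>L. L-lipschitz_on (coord_subspace I) gt) \<and>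
     \<beta> \<in> coord_subspace (- I) \<and>
     (\<forall>x. g x = gt (coord_proj I x) + \<beta> \<bullet> coord_proj (- I) x)"

lemma gradient_eqI:
  assumes "GDERIV \<Phi> z :> D"
  shows "gradient \<Phi> z = D"
  unfolding gradient_def
proof (rule the_equality)
  show "GDERIV \<Phi> z :> D" by (rule assms)
next
  fix D' assume "GDERIV \<Phi> z :> D'"
  with assms have "(\<lambda>h. h \<bullet> D') = (\<lambda>h. h \<bullet> D)"
    unfolding gderiv_def using has_derivative_unique by blast
  then show "D' = D"
    by (metis vector_eq_ldot)
qed

lemma bregman_div_quadratic_form:
  fixes Q :: "real ^ 'n ^ 'n"
  assumes "transpose Q = Q"
  shows "bregman_div (\<lambda>x. x \<bullet> (Q *v x)) z1 z2 = (z1 - z2) \<bullet> (Q *v (z1 - z2))"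
proof -
  have sym: "x \<bullet> (Q *v y) = y \<bullet> (Q *v x)" for x y
    by (metis assms dot_lmul_matrix inner_commute transpose_matrix_vector)
  have "((\<lambda>x. x \<bullet> (Q *v x)) has_derivative (\<lambda>h. z2 \<bullet> (Q *v h) + h \<bullet> (Q *v z2))) (at z2)"
    by (intro has_derivative_inner has_derivative_ident
        bounded_linear.has_derivative[OF matrix_vector_mul_bounded_linear])
  then have "GDERIV (\<lambda>x. x \<bullet> (Q *v x)) z2 :> 2 *\<^sub>R (Q *v z2)"
    unfolding gderiv_def by (simp add: sym[of z2] algebra_simps)
  then show ?thesis
    using sym[of z1 z2]
    by (simp add: bregman_div_def gradient_eqI algebra_simps
        inner_commute[of "Q *v z2"] matrix_vector_mult_diff_distrib)
qed

lemma bregman_div_square: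
  fixes c z1 z2 :: real
  shows "bregman_div (\<lambda>x. c * x\<^sup>2) z1 z2 = c * (z1 - z2)\<^sup>2"
proof -
  have "GDERIV (\<lambda>x. c * x\<^sup>2) z2 :> 2 * c * z2"
    unfolding gderiv_def by (auto intro!: derivative_eq_intros simp: algebra_simps)
  then show ?thesis
    by (simp add: bregman_div_def gradient_eqI algebra_simps power2_eq_square)
qed

end

theory Submission
  imports Defs
begin

text \<open>
  Upper bound: a coupling of \<open>Y\<close> and \<open>X\<close> is pushed forward by \<open>g\<close>, and
  \<open>\<lambda>\<^sub>m\<^sub>i\<^sub>n (g y - g x)\<^sup>2 \<le> K\<^sup>2 (y - x)\<^sup>T Q (y - x)\<close>.

  Lower bound: move \<open>X\<close> in direction \<open>\<beta>\<close>, to \<open>Z = X + ((Y' - g X) / \<parallel>\<beta>\<parallel>\<^sup>2) \<beta>\<close>, so that \<open>g Z = Y'\<close>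
  and \<open>(Z - X)\<^sup>T Q (Z - X) \<le> \<lambda>\<^sub>m\<^sub>a\<^sub>x (Y' - g X)\<^sup>2 / \<parallel>\<beta>\<parallel>\<^sup>2\<close>. Since \<open>\<rho>\<close> need not be continuous, \<open>Y'\<close> must
  attain the infimum over the couplings with the given random variable \<open>G = g X\<close>. It is obtained as
  the comonotone coupling. As the space is non-atomic and standard Borel, the atoms of \<open>G\<close> can be
  spread out to give a \<open>T\<close> of continuous distribution of which \<open>G\<close> is a monotone function, and
  \<open>Y' = F\<^sub>Y\<^sup>-\<^sup>1 (F\<^sub>T (T))\<close>. As second moments may be infinite, its optimality is
  read off the layer-cake formula for \<open>E (X - Y)\<^sup>2\<close>, in which the law of the coupling enters only
  through \<open>P (X \<le> a, b < Y)\<close> and \<open>P (Y \<le> a, b < X)\<close>.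
\<close>

subsection \<open>Continuous distributions on non-atomic spaces\<close>

text \<open>A subset of a singleton is empty or everything, so no mass lies strictly in between.
  This makes the level sets of an injective function null.\<close>

lemma nonatomic_singleton_null:
  assumes "nonatomic M" "{x} \<in> sets M"
  shows "emeasure M {x} = 0"
proof (rule ccontr)
  assume "emeasure M {x} \<noteq> 0"
  then obtain B where "B \<subseteq> {x}" "0 < emeasure M B" "emeasure M B < emeasure M {x}"
    using assms unfolding nonatomic_def by (metis gr_zeroI)
  then show False
    by (auto simp: subset_singleton_iff)
qed

text \<open>With digits 0 and 1 in base 4 the tail after the leading digit contributes at most 1/3 <
  1, so the sum determines that digit; then the digit is stripped off. In base 2 the tail can reach
  1, and expansions are ambiguous.\<close>

lemma quaternary_digits_unique:
  fixes a b :: "nat \<Rightarrow> real"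
  assumes "range a \<subseteq> {0, 1}" "range b \<subseteq> {0, 1}"
    and "(\<Sum>n. a n * (1/4) ^ n) = (\<Sum>n. b n * (1/4) ^ n)"
  shows "a n = b n"
  using assms
proof (induction n arbitrary: a b)
  have summable: "summable (\<lambda>n. a n * (1/4) ^ n)" if "range a \<subseteq> {0, 1}" for a :: "nat \<Rightarrow> real"
  proof (rule summable_comparison_test)
    show "summable (\<lambda>n. (1/4::real) ^ n)" by (simp add: summable_geometric)
    show "\<exists>N. \<forall>n\<ge>N. norm (a n * (1/4) ^ n) \<le> (1/4) ^ n"
    proof (intro exI allI impI)
      fix n show "norm (a n * (1/4) ^ n) \<le> (1/4) ^ n"
        using that[unfolded image_subset_iff, rule_format, of n] by auto
    qed
  qed
  have bounds: "0 \<le> (\<Sum>n. a n * (1/4) ^ n)" "(\<Sum>n. a n * (1/4) ^ n) \<le> 4/3"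
    if "range a \<subseteq> {0, 1}" for a :: "nat \<Rightarrow> real"
  proof -
    have a: "a n = 0 \<or> a n = 1" for n
      using that by auto
    show "0 \<le> (\<Sum>n. a n * (1/4) ^ n)"
      using a by (intro suminf_nonneg summable that) (metis mult_zero_left mult_1 order_refl zero_le_power zero_le_divide_1_iff zero_le_numeral)
    have "(\<Sum>n. a n * (1/4) ^ n) \<le> (\<Sum>n. (1/4) ^ n)"
    proof (intro suminf_le summable that)
      show "a n * (1/4) ^ n \<le> (1/4) ^ n" for n
        using a[of n] by auto
    qed (simp add: summable_geometric)
    then show "(\<Sum>n. a n * (1/4) ^ n) \<le> 4/3"
      by (simp add: suminf_geometric)
  qed
  have step: "a 0 = b 0 \<and> (\<Sum>n. a (Suc n) * (1/4) ^ n) = (\<Sum>n. b (Suc n) * (1/4) ^ n)"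
    if "range a \<subseteq> {0, 1}" "range b \<subseteq> {0, 1}"
      "(\<Sum>n. a n * (1/4) ^ n) = (\<Sum>n. b n * (1/4) ^ n)" for a b :: "nat \<Rightarrow> real"
  proof -
    have head: "(\<Sum>n. a n * (1/4) ^ n) = a 0 + (\<Sum>n. a (Suc n) * (1/4) ^ n) / 4"
      if "range a \<subseteq> {0, 1}" for a :: "nat \<Rightarrow> real"
    proof -
      have tail: "range (\<lambda>n. a (Suc n)) \<subseteq> {0, 1}"
        using that by auto
      show ?thesis
        using suminf_split_head[OF summable[OF that]] suminf_mult[OF summable[OF tail], of "1/4"]
        by (simp add: algebra_simps)
    qed
    have tails: "range (\<lambda>n. a (Suc n)) \<subseteq> {0, 1}" "range (\<lambda>n. b (Suc n)) \<subseteq> {0, 1}"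
      using that by auto
    have "a 0 \<in> {0, 1}" "b 0 \<in> {0, 1}"
      using that by blast+
    then show ?thesis
      using bounds[OF tails(1)] bounds[OF tails(2)] that(3) head[OF that(1)] head[OF that(2)] by auto
  qed
  {
    case 0
    show ?case using step[OF 0] by (rule conjunct1)
  next
    case (Suc n)
    show ?case
    proof (rule Suc.IH)
      show "range (\<lambda>n. a (Suc n)) \<subseteq> {0, 1}" "range (\<lambda>n. b (Suc n)) \<subseteq> {0, 1}"
        using Suc.prems(1,2) by blast+
      show "(\<Sum>n. a (Suc n) * (1/4) ^ n) = (\<Sum>n. b (Suc n) * (1/4) ^ n)"
        using step[OF Suc.prems] by (rule conjunct2)
    qed
  }
qed

text \<open>A countable basis of a T0 space separates points, so the indicators of the basic sets at
  \<open>x\<close> form a 0-1 sequence that determines \<open>x\<close>. Reading the sequence in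
  base 4 turns it into one real number. On a non-atomic Borel space such a map has a continuous
  distribution.\<close>

lemma ex_injective_borel_real:
  "\<exists>V :: 'a::{second_countable_topology, t0_space} \<Rightarrow> real.
     V \<in> borel_measurable borel \<and> inj V \<and> (\<forall>x. 0 \<le> V x \<and> V x \<le> 1)"
proof -
  obtain B :: "'a set set" where B: "countable B" "topological_basis B"
    using ex_countable_basis by blast
  have "B \<noteq> {}"
    using topological_basisE[OF B(2) open_UNIV UNIV_I] by blast
  define b where "b = from_nat_into B"
  have b: "b n \<in> B" for n
    unfolding b_def using \<open>B \<noteq> {}\<close> by (rule from_nat_into)
  have [measurable]: "b n \<in> sets borel" for n
    using b topological_basis_open[OF B(2)] by (intro borel_open) auto
  define S where "S x = (\<Sum>n. indicator (b n) x * (1/4) ^ n :: real)" for x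
  have summable: "summable (\<lambda>n. indicator (b n) x * (1/4) ^ n :: real)" for x
    by (rule summable_comparison_test[OF _ summable_geometric[of "1/4"]])
      (auto simp: indicator_def)
  have S: "S \<in> borel_measurable borel"
    unfolding S_def by measurable
  have nonneg: "0 \<le> S x" for x
    unfolding S_def by (intro suminf_nonneg summable) auto
  have "S x \<le> (\<Sum>n. (1/4) ^ n)" for x
    unfolding S_def by (intro suminf_le summable) (auto simp: summable_geometric indicator_def)
  then have le: "S x \<le> 4/3" for x
    by (simp add: suminf_geometric)
  have "inj S"
  proof (rule injI, rule ccontr)
    fix x y assume eq: "S x = S y" and "x \<noteq> y"
    have digits: "(indicator (b n) x :: real) = indicator (b n) y" for n
      by (rule quaternary_digits_unique) (use eq in \<open>auto simp: S_def indicator_def\<close>)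
    obtain U where "open U" and U: "\<not> (x \<in> U \<longleftrightarrow> y \<in> U)"
      using \<open>x \<noteq> y\<close> separation_t0[of x y] by blast
    obtain z z' where z: "z \<in> U" "z' \<notin> U" "z = x \<and> z' = y \<or> z = y \<and> z' = x"
      using U by blast
    obtain A where A: "A \<in> B" "z \<in> A" "A \<subseteq> U"
      using topological_basisE[OF B(2) \<open>open U\<close> z(1)] by blast
    obtain n where "A = b n"
      using from_nat_into_surj[OF B(1) A(1)] unfolding b_def by metis
    then have "z \<in> A \<longleftrightarrow> z' \<in> A"
      using z(3) digits[of n] by (auto simp: indicator_def split: if_splits)
    then show False
      using A z by blast
  qed
  show ?thesis
  proof (intro exI conjI allI)
    \<comment> \<open>Halving brings the range, within [0, 4/3], into [0, 1].\<close>
    show "(\<lambda>x. S x / 2) \<in> borel_measurable borel"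
      using S by measurable
    show "inj (\<lambda>x. S x / 2)"
      using \<open>inj S\<close> by (simp add: inj_on_def)
    show "0 \<le> S x / 2" "S x / 2 \<le> 1" for x
      using nonneg[of x] le[of x] by auto
  qed
qed

section \<open>Atomless refinements and the probability integral transform\<close>

context prob_space
begin

text \<open>The third property says that \<open>G\<close> is a monotone function of
  \<open>T\<close>, in the form used later: sublevel sets of \<open>G\<close> are sublevel sets of
  \<open>T\<close>. No independence of \<open>G\<close> and \<open>V\<close> is involved, as the
  spreading happens within a single level set of \<open>G\<close>.\<close>

lemma ex_atomless_refinement:
  fixes G V :: "'a \<Rightarrow> real"
  assumes [measurable]: "random_variable borel G" "random_variable borel V"
    and V01: "V \<in> space M \<rightarrow> {0..1}"
    and V_atomless: "\<And>v. prob {w \<in> space M. V w = v} = 0"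
  obtains T :: "'a \<Rightarrow> real" and c where "random_variable borel T"
    and "\<And>t. prob {w \<in> space M. T w = t} = 0"
    and "\<And>s w. w \<in> space M \<Longrightarrow> G w \<le> s \<longleftrightarrow> T w \<le> c s"
proof -
  define L where "L x = prob {w \<in> space M. G w < x}" for x
  define F where "F x = prob {w \<in> space M. G w \<le> x}" for x
  have "mono L" "mono F"
    unfolding mono_def L_def F_def by (auto intro!: finite_measure_mono)
  then have [measurable]: "L \<in> borel_measurable borel" "F \<in> borel_measurable borel"
    by (auto intro: borel_measurable_mono)
  have LF: "L x \<le> F x" for x
    unfolding L_def F_def by (auto intro!: finite_measure_mono)
  have FL: "F x \<le> L y" if "x < y" for x y
    unfolding L_def F_def using that by (auto intro!: finite_measure_mono)
  have atom: "prob {w \<in> space M. G w = x} = F x - L x" for x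
  proof -
    have "F x = prob ({w \<in> space M. G w < x} \<union> {w \<in> space M. G w = x})"
      unfolding F_def by (rule arg_cong[where f = prob]) auto
    also have "\<dots> = L x + prob {w \<in> space M. G w = x}"
      unfolding L_def by (rule finite_measure_Union) auto
    finally show ?thesis
      by simp
  qed
  txt \<open>At an atom \<open>x\<close> of \<open>G\<close> the function \<open>T\<close> skips an interval whose length is the mass of the
    atom, and \<open>V\<close> spreads the mass over that interval.\<close>
  define T where "T w = G w + L (G w) + (F (G w) - L (G w)) * V w" for w
  have T[measurable]: "random_variable borel T"
    unfolding T_def by measurable
  \<comment> \<open>The summand \<open>s\<close> makes the comparison strict: for
    \<open>G w > s\<close> one has \<open>T w \<ge> G w + L (G w) > s + F s\<close>, even where
    \<open>F s = L (G w)\<close>.\<close>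
  define c where "c s = s + F s" for s
  have iff: "G w \<le> s \<longleftrightarrow> T w \<le> c s" if w: "w \<in> space M" for s w
  proof
    assume "G w \<le> s"
    moreover have "(F (G w) - L (G w)) * V w \<le> F (G w) - L (G w)"
      using funcset_mem[OF V01 w] LF[of "G w"] by (simp add: mult_left_le)
    moreover have "F (G w) \<le> F s"
      using \<open>mono F\<close> \<open>G w \<le> s\<close> by (rule monoD)
    ultimately show "T w \<le> c s"
      unfolding T_def c_def by linarith
  next
    assume T_le: "T w \<le> c s"
    have "0 \<le> (F (G w) - L (G w)) * V w"
      using funcset_mem[OF V01 w] LF[of "G w"] by simp
    then show "G w \<le> s"
      using T_le FL[of s "G w"] unfolding T_def c_def by linarith
  qed
  have "prob {w \<in> space M. T w = t} = 0" for t
  proof (cases "\<exists>w0\<in>space M. T w0 = t")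
    case False
    then have "{w \<in> space M. T w = t} = {}"
      by auto
    then show ?thesis by (simp only: measure_empty)
  next
    case True
    then obtain w0 where w0: "w0 \<in> space M" "T w0 = t"
      by blast
    \<comment> \<open>Whether \<open>G w \<le> s\<close> depends on \<open>T w\<close> only, so
      \<open>T\<close> separates the values of \<open>G\<close>.\<close>
    have G_eq: "G w = G w0" if "w \<in> space M" "T w = t" for w
      using iff[OF that(1), of "G w0"] iff[OF w0(1), of "G w"] iff[OF that(1), of "G w"]
        iff[OF w0(1), of "G w0"] that w0 by force
    \<comment> \<open>If \<open>G w0\<close> is not an atom of \<open>G\<close>, the level set of
      \<open>T\<close> lies in a null level set of \<open>G\<close>. At an atom the factor
      \<open>F - L\<close> is non-zero, \<open>T\<close> determines \<open>V\<close>, and the level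
      set of \<open>T\<close> lies in a null level set of \<open>V\<close>.\<close>
    show ?thesis
    proof (cases "F (G w0) = L (G w0)")
      case True
      have "prob {w \<in> space M. T w = t} \<le> prob {w \<in> space M. G w = G w0}"
        using G_eq by (intro finite_measure_mono) auto
      then show ?thesis
        using atom[of "G w0"] True by (simp add: measure_le_0_iff)
    next
      case False
      have "V w = V w0" if "w \<in> space M" "T w = t" for w
        proof -
        have "(F (G w0) - L (G w0)) * V w = (F (G w0) - L (G w0)) * V w0"
          using G_eq[OF that] that(2) w0(2) unfolding T_def by (metis add_left_cancel)
        then show ?thesis
          using False by simp
      qed
      then have "prob {w \<in> space M. T w = t} \<le> prob {w \<in> space M. V w = V w0}"
        by (intro finite_measure_mono) auto
      then show ?thesis
        using V_atomless[of "V w0"] by (simp add: measure_le_0_iff)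
    qed
  qed
  then show thesis
    using T iff that by blast
qed

text \<open>The law of \<open>T\<close> is that of its quantile function \<open>N.I\<close> under
  the uniform law on (0, 1), and the cdf inverts \<open>N.I\<close> exactly because it is
  continuous.\<close>

lemma distr_cdf_transform:
  fixes T :: "'a \<Rightarrow> real"
  assumes [measurable]: "random_variable borel T"
    and atomless: "\<And>t. prob {w \<in> space M. T w = t} = 0"
  shows "distr M borel (\<lambda>w. cdf (distr M borel T) (T w)) =
    distr (restrict_space lborel {0<..<1}) borel (\<lambda>x. x)"
proof -
  let ?N = "distr M borel T" and ?R = "restrict_space lborel {0<..<1::real}"
  interpret N: cdf_distribution ?N
    unfolding cdf_distribution_def by simp
  have C_I: "N.C (N.I u) = u" if u: "0 < u" "u < 1" for u
  proof (rule antisym)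
    show "u \<le> N.C (N.I u)"
      using N.pseudoinverse[OF u, of "N.I u"] by simp
    \<comment> \<open>Without an atom at \<open>N.I u\<close> the cdf is left continuous there, and
      it stays below \<open>u\<close> to the left of \<open>N.I u\<close> by the Galois connection
      \<open>u \<le> N.C x \<longleftrightarrow> N.I u \<le> x\<close>.\<close>
    have "measure ?N {N.I u} = 0"
      using atomless[of "N.I u"] by (simp add: measure_distr vimage_def Int_def conj_commute)
    then have "isCont N.C (N.I u)"
      by (simp add: N.isCont_cdf)
    then have "(N.C \<longlongrightarrow> N.C (N.I u)) (at_left (N.I u))"
      by (auto simp: isCont_def intro: filterlim_at_split[THEN iffD1, THEN conjunct1])
    moreover have "\<forall>\<^sub>F x in at_left (N.I u). N.C x \<le> u"
      unfolding eventually_at_left_field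
      proof (intro exI conjI allI impI)
      show "N.I u - 1 < N.I u" by simp
      show "N.C x \<le> u" if "x < N.I u" for x
        using N.pseudoinverse[OF u, of x] that by linarith
    qed
    ultimately show "N.C (N.I u) \<le> u"
      by (rule tendsto_upperbound) simp
  qed
  have [measurable]: "N.I \<in> borel_measurable ?R"
    using N.measurable_CI by (subst measurable_cong_sets[OF sets_restrict_space_cong[OF sets_lborel] refl])
  have "distr M borel (\<lambda>w. N.C (T w)) = distr ?N borel N.C"
    by (simp add: distr_distr comp_def)
  also have "\<dots> = distr (distr ?R borel N.I) borel N.C"
    by (simp only: N.distr_I_eq_M)
  also have "\<dots> = distr ?R borel (\<lambda>u. N.C (N.I u))"
    by (subst distr_distr) (auto simp: comp_def)
  also have "\<dots> = distr ?R borel (\<lambda>x. x)"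
    by (rule distr_cong) (auto simp: space_restrict_space C_I)
  finally show ?thesis .
qed

subsection \<open>Optimal couplings on the real line\<close>

text \<open>The squared positive part is the area of the square with side
  \<open>{X w..<Y w}\<close>; Tonelli then moves the integral over \<open>M\<close> inside.
  Everything takes place in [0, \<infinity>], so infinite second moments are covered.\<close>

lemma nn_integral_pos_part_square:
  fixes X Y :: "'a \<Rightarrow> real"
  assumes [measurable]: "random_variable borel X" "random_variable borel Y"
  shows "(\<integral>\<^sup>+ w. ennreal ((max 0 (Y w - X w))\<^sup>2) \<partial>M) =
    (\<integral>\<^sup>+ s. \<integral>\<^sup>+ t. emeasure M {w \<in> space M. X w \<le> min s t \<and> max s t < Y w} \<partial>lborel \<partial>lborel)"
proof -
  interpret pair_sigma_finite M lborel ..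
  define k :: "'a \<Rightarrow> real \<Rightarrow> real \<Rightarrow> ennreal" where
    "k w s t = (if X w \<le> s \<and> s < Y w \<and> X w \<le> t \<and> t < Y w then 1 else 0)" for w s t
  have "(\<integral>\<^sup>+ s. \<integral>\<^sup>+ t. k w s t \<partial>lborel \<partial>lborel) = ennreal ((max 0 (Y w - X w))\<^sup>2)" for w
  proof -
    have "k w s t = indicator {X w..<Y w} s * indicator {X w..<Y w} t" for s t
      by (auto simp: k_def indicator_def)
    then show ?thesis
      by (cases "X w \<le> Y w")
        (simp_all add: nn_integral_cmult nn_integral_multc ennreal_mult[symmetric] power2_eq_square)
  qed
  then have "(\<integral>\<^sup>+ w. ennreal ((max 0 (Y w - X w))\<^sup>2) \<partial>M) =
      (\<integral>\<^sup>+ w. \<integral>\<^sup>+ s. \<integral>\<^sup>+ t. k w s t \<partial>lborel \<partial>lborel \<partial>M)"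
    by simp
  also have "\<dots> = (\<integral>\<^sup>+ s. \<integral>\<^sup>+ w. \<integral>\<^sup>+ t. k w s t \<partial>lborel \<partial>M \<partial>lborel)"
    by (rule Fubini'[symmetric]) (unfold k_def, measurable)
  also have "\<dots> = (\<integral>\<^sup>+ s. \<integral>\<^sup>+ t. \<integral>\<^sup>+ w. k w s t \<partial>M \<partial>lborel \<partial>lborel)"
    by (intro nn_integral_cong Fubini'[symmetric]) (unfold k_def, measurable)
  also have "\<dots> = (\<integral>\<^sup>+ s. \<integral>\<^sup>+ t. emeasure M {w \<in> space M. X w \<le> min s t \<and> max s t < Y w}
      \<partial>lborel \<partial>lborel)"
  proof (intro nn_integral_cong)
    fix s t
    have "(\<integral>\<^sup>+ w. k w s t \<partial>M) =
        (\<integral>\<^sup>+ w. indicator {w \<in> space M. X w \<le> min s t \<and> max s t < Y w} w \<partial>M)"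
      by (intro nn_integral_cong) (auto simp: k_def indicator_def)
    then show "(\<integral>\<^sup>+ w. k w s t \<partial>M) = emeasure M {w \<in> space M. X w \<le> min s t \<and> max s t < Y w}"
      by (subst (asm) nn_integral_indicator) auto
  qed
  finally show ?thesis .
qed

text \<open>The square of \<open>X - Y\<close> is the sum of the squares of its positive and
  negative parts. The layer-cake formula compares each at \<open>a = min s t\<close> and
  \<open>b = max s t\<close>, whence the restriction to \<open>a \<le> b\<close>.\<close>

lemma nn_integral_square_diff_mono:
  fixes X Y X' Y' :: "'a \<Rightarrow> real"
  assumes [measurable]: "random_variable borel X" "random_variable borel Y"
      "random_variable borel X'" "random_variable borel Y'"
    and le1: "\<And>a b. a \<le> b \<Longrightarrow> prob {w \<in> space M. X w \<le> a \<and> b < Y w} \<le> prob {w \<in> space M. X' w \<le> a \<and> b < Y' w}"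
    and le2: "\<And>a b. a \<le> b \<Longrightarrow> prob {w \<in> space M. Y w \<le> a \<and> b < X w} \<le> prob {w \<in> space M. Y' w \<le> a \<and> b < X' w}"
  shows "(\<integral>\<^sup>+ w. ennreal ((X w - Y w)\<^sup>2) \<partial>M) \<le> (\<integral>\<^sup>+ w. ennreal ((X' w - Y' w)\<^sup>2) \<partial>M)"
proof -
  have split: "(\<integral>\<^sup>+ w. ennreal ((X w - Y w)\<^sup>2) \<partial>M) =
      (\<integral>\<^sup>+ w. ennreal ((max 0 (Y w - X w))\<^sup>2) \<partial>M) + (\<integral>\<^sup>+ w. ennreal ((max 0 (X w - Y w))\<^sup>2) \<partial>M)"
    if [measurable]: "random_variable borel X" "random_variable borel Y" for X Y :: "'a \<Rightarrow> real"
  proof (subst nn_integral_add[symmetric])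
    show "(\<integral>\<^sup>+ w. ennreal ((X w - Y w)\<^sup>2) \<partial>M) =
      (\<integral>\<^sup>+ w. ennreal ((max 0 (Y w - X w))\<^sup>2) + ennreal ((max 0 (X w - Y w))\<^sup>2) \<partial>M)"
      by (intro nn_integral_cong) (auto simp: max_def power2_commute)
  qed measurable
  show ?thesis
    unfolding split[OF assms(1,2)] split[OF assms(3,4)]
    by (simp only: nn_integral_pos_part_square assms emeasure_eq_measure)
      (intro add_mono nn_integral_mono ennreal_leI le1 le2; simp)
qed

text \<open>The bound is attained, for all \<open>a\<close> and \<open>b\<close> at once, by comonotone couplings.\<close>

lemma prob_le_and_greater_ge:
  fixes X Y :: "'a \<Rightarrow> real"
  assumes [measurable]: "random_variable borel X" "random_variable borel Y"
  shows "max 0 (prob {w \<in> space M. X w \<le> a} - prob {w \<in> space M. Y w \<le> b})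
    \<le> prob {w \<in> space M. X w \<le> a \<and> b < Y w}"
proof -
  have "prob {w \<in> space M. X w \<le> a}
      \<le> prob ({w \<in> space M. X w \<le> a \<and> b < Y w} \<union> {w \<in> space M. Y w \<le> b})"
    by (intro finite_measure_mono) auto
  also have "\<dots> \<le> prob {w \<in> space M. X w \<le> a \<and> b < Y w} + prob {w \<in> space M. Y w \<le> b}"
    by (intro measure_Un_le) auto
  finally show ?thesis
    by simp
qed

lemma prob_le_eq_cdf:
  assumes "random_variable borel X" "distr M borel X = N"
  shows "prob {w \<in> space M. X w \<le> a} = cdf N a"
  unfolding assms(2)[symmetric]
  using assms(1) by (simp add: cdf_def measure_distr vimage_def Int_def conj_commute)

text \<open>\<open>Z\<close> is a quantile transform of a uniform \<open>U\<close>, and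
  \<open>U\<close> is monotone in the variable \<open>T\<close> that orders \<open>G\<close>. Hence
  the events \<open>Z \<le> a, b < G\<close> and \<open>G \<le> a, b < Z\<close> confine
  \<open>U\<close> to intervals whose lengths are the lower bounds of
  \<open>prob_le_and_greater_ge\<close>, which hold for every coupling.\<close>

lemma ex_optimal_quadratic_coupling:
  fixes G V :: "'a \<Rightarrow> real"
  assumes G[measurable]: "random_variable borel G" and V: "random_variable borel V"
    and V01: "V \<in> space M \<rightarrow> {0..1}"
    and V_atomless: "\<And>v. prob {w \<in> space M. V w = v} = 0"
    and N: "real_distribution N"
  shows "\<exists>Z. random_variable borel Z \<and> distr M borel Z = N \<and>
    (\<forall>Y X. random_variable borel Y \<longrightarrow> random_variable borel X \<longrightarrow>
       distr M borel Y = N \<longrightarrow> distr M borel X = distr M borel G \<longrightarrow>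
       (\<integral>\<^sup>+ w. ennreal ((Z w - G w)\<^sup>2) \<partial>M) \<le> (\<integral>\<^sup>+ w. ennreal ((Y w - X w)\<^sup>2) \<partial>M))"
proof -
  obtain T :: "'a \<Rightarrow> real" and c where T[measurable]: "random_variable borel T"
    and T_atomless: "\<And>t. prob {w \<in> space M. T w = t} = 0"
    and G_iff: "\<And>s w. w \<in> space M \<Longrightarrow> G w \<le> s \<longleftrightarrow> T w \<le> c s"
    using ex_atomless_refinement[OF G V V01 V_atomless] by blast
  interpret N: cdf_distribution N
    unfolding cdf_distribution_def by (rule N)
  interpret T: cdf_distribution "distr M borel T"
    unfolding cdf_distribution_def by simp
  let ?R = "restrict_space lborel {0<..<1::real}"
  have [measurable]: "(\<lambda>x. x) \<in> borel_measurable ?R"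
    by (rule measurable_restrict_space1) simp
  define U where "U w = T.C (T w)" for w
  have U[measurable]: "random_variable borel U"
    unfolding U_def by measurable
  have U_distr: "distr M borel U = distr ?R borel (\<lambda>x. x)"
    unfolding U_def by (rule distr_cdf_transform[OF T T_atomless])
  have U_prob: "prob {w \<in> space M. U w \<in> A} = measure lborel (A \<inter> {0<..<1})" if [measurable]: "A \<in> sets borel" for A
  proof -
    have "prob {w \<in> space M. U w \<in> A} = measure (distr M borel U) A"
      by (simp add: measure_distr vimage_def Int_def conj_commute)
    also have "\<dots> = measure ?R (A \<inter> {0<..<1})"
      unfolding U_distr by (subst measure_distr) (auto simp: space_restrict_space)
    also have "\<dots> = measure lborel (A \<inter> {0<..<1})"
      by (rule measure_restrict_space) auto
    finally show ?thesis .
  qed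
  have U_AE: "AE w in M. 0 < U w \<and> U w < 1"
  proof -
    have "prob {w \<in> space M. U w \<in> {0<..<1}} = 1"
      by (subst U_prob) auto
    then show ?thesis
      by (subst prob_Collect_eq_1[symmetric]) auto
  qed
  have U_interval: "prob {w \<in> space M. U w \<in> {a..b}} \<le> max 0 (b - a)" for a b
  proof -
    have "measure lborel ({a..b} \<inter> {0<..<1}) \<le> measure lborel {a..b}"
      by (intro measure_mono_fmeasurable) (auto intro!: fmeasurableI simp: emeasure_lborel_Icc_eq)
    then show ?thesis
      by (subst U_prob) (auto simp: max_def split: if_splits)
  qed
  \<comment> \<open>The quantile function is meaningful on (0, 1) only. Extending it by 0 gives a
    Borel function on the whole line, and \<open>U\<close> leaves (0, 1) only on a null set.\<close>
  define q where "q u = indicator {0<..<1} u * N.I u" for u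
  have [measurable]: "N.I \<in> borel_measurable ?R"
    using N.measurable_CI by (subst measurable_cong_sets[OF sets_restrict_space_cong[OF sets_lborel] refl])
  have [measurable]: "q \<in> borel_measurable borel"
    using N.measurable_CI
    by (subst (asm) borel_measurable_restrict_space_iff) (simp_all add: q_def[abs_def])
  define Z where "Z w = q (U w)" for w
  have Z[measurable]: "random_variable borel Z"
    unfolding Z_def by measurable
  have "distr M borel Z = distr (distr M borel U) borel q"
    by (simp add: distr_distr comp_def Z_def[abs_def])
  also have "\<dots> = distr ?R borel q"
    unfolding U_distr by (subst distr_distr) (auto simp: comp_def)
  also have "\<dots> = distr ?R borel N.I"
    by (rule distr_cong) (auto simp: space_restrict_space q_def)
  finally have Z_distr: "distr M borel Z = N"
    by (simp only: N.distr_I_eq_M)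
  have Z_le: "Z w \<le> t \<longleftrightarrow> U w \<le> N.C t" if "0 < U w" "U w < 1" for w t
    unfolding Z_def q_def using that N.pseudoinverse[OF that, of t] by simp
  have cdf_G: "prob {w \<in> space M. G w \<le> s} = T.C (c s)" for s
  proof -
    have "{w \<in> space M. G w \<le> s} = {w \<in> space M. T w \<le> c s}"
      using G_iff by auto
    then show ?thesis
      using prob_le_eq_cdf[OF T refl] by simp
  qed
  have ZG: "prob {w \<in> space M. Z w \<le> a \<and> b < G w} \<le> max 0 (N.C a - prob {w \<in> space M. G w \<le> b})" for a b
  proof -
    \<comment> \<open>From \<open>c b < T w\<close> the cdf of \<open>T\<close> yields only a weak
      inequality, as it may be flat. The closed interval costs nothing, since \<open>U\<close> is
      uniform.\<close>
    have "AE w in M. Z w \<le> a \<and> b < G w \<longrightarrow> U w \<in> {T.C (c b)..N.C a}"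
      using U_AE AE_space
    proof eventually_elim
      case (elim w)
      have "T.C (c b) \<le> U w" if "b < G w"
        unfolding U_def using G_iff[OF elim(2), of b] that by (intro T.cdf_nondecreasing) simp
      then show ?case
        using Z_le elim by auto
    qed
    then have "prob {w \<in> space M. Z w \<le> a \<and> b < G w} \<le> prob {w \<in> space M. U w \<in> {T.C (c b)..N.C a}}"
      by (intro finite_measure_mono_AE) auto
    then show ?thesis
      unfolding cdf_G using U_interval order_trans by blast
  qed
  have GZ: "prob {w \<in> space M. G w \<le> a \<and> b < Z w} \<le> max 0 (prob {w \<in> space M. G w \<le> a} - N.C b)" for a b
  proof -
    have "AE w in M. G w \<le> a \<and> b < Z w \<longrightarrow> U w \<in> {N.C b..T.C (c a)}"
      using U_AE AE_space
    proof eventually_elim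
      case (elim w)
      have "U w \<le> T.C (c a)" if "G w \<le> a"
        unfolding U_def using G_iff[OF elim(2), of a] that by (intro T.cdf_nondecreasing) simp
      then show ?case
        using Z_le[of w b] elim by auto
    qed
    then have "prob {w \<in> space M. G w \<le> a \<and> b < Z w} \<le> prob {w \<in> space M. U w \<in> {N.C b..T.C (c a)}}"
      by (intro finite_measure_mono_AE) auto
    then show ?thesis
      unfolding cdf_G using U_interval order_trans by blast
  qed
  have "(\<integral>\<^sup>+ w. ennreal ((Z w - G w)\<^sup>2) \<partial>M) \<le> (\<integral>\<^sup>+ w. ennreal ((Y w - X w)\<^sup>2) \<partial>M)"
    if Y[measurable]: "random_variable borel Y" and X[measurable]: "random_variable borel X"
      and YN: "distr M borel Y = N" and XG: "distr M borel X = distr M borel G" for Y X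
  proof (rule nn_integral_square_diff_mono)
    fix a b :: real
    have G_X: "prob {w \<in> space M. G w \<le> s} = prob {w \<in> space M. X w \<le> s}" for s
      using prob_le_eq_cdf[OF G refl] prob_le_eq_cdf[OF X XG] by simp
    show "prob {w \<in> space M. Z w \<le> a \<and> b < G w} \<le> prob {w \<in> space M. Y w \<le> a \<and> b < X w}"
      using ZG[of a b] prob_le_and_greater_ge[OF Y X, of a b]
      unfolding G_X prob_le_eq_cdf[OF Y YN] by linarith
    show "prob {w \<in> space M. G w \<le> a \<and> b < Z w} \<le> prob {w \<in> space M. X w \<le> a \<and> b < Y w}"
      using GZ[of a b] prob_le_and_greater_ge[OF X Y, of a b]
      unfolding G_X prob_le_eq_cdf[OF Y YN] by linarith
  qed measurable
  then show ?thesis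
    using Z Z_distr by blast
qed

end

subsection \<open>Bregman-Wasserstein uncertainty sets\<close>

text \<open>The sum of two norms is at most twice their maximum, and the \<open>p\<close>-th power
  of the maximum is at most the sum of the \<open>p\<close>-th powers. Three value types allow
  scalars and vectors to be mixed.\<close>

lemma Lp_spaceI_bound:
  fixes Z :: "'w \<Rightarrow> 'a::euclidean_space" and A :: "'w \<Rightarrow> 'b::euclidean_space"
    and B :: "'w \<Rightarrow> 'c::euclidean_space"
  assumes [measurable]: "Z \<in> borel_measurable M" and "A \<in> Lp_space M p" "B \<in> Lp_space M p"
    and "0 \<le> p" "0 \<le> c"
    and bound: "\<And>w. norm (Z w) \<le> c * (norm (A w) + norm (B w))"
  shows "Z \<in> Lp_space M p"
proof -
  have "integrable M (\<lambda>w. norm (Z w) powr p)"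
  proof (rule Bochner_Integration.integrable_bound)
    show "integrable M (\<lambda>w. (2 * c) powr p * (norm (A w) powr p + norm (B w) powr p))"
      using assms(2,3) by (simp add: Lp_space_def)
    show "AE w in M. norm (norm (Z w) powr p)
        \<le> norm ((2 * c) powr p * (norm (A w) powr p + norm (B w) powr p))"
    proof (rule AE_I2)
      fix w
      let ?m = "max (norm (A w)) (norm (B w))"
      have "norm (Z w) \<le> c * (2 * ?m)"
        using \<open>0 \<le> c\<close> by (intro order_trans[OF bound] mult_left_mono) auto
      then have "norm (Z w) powr p \<le> (2 * c * ?m) powr p"
        using \<open>0 \<le> p\<close> by (intro powr_mono2) (auto simp: ac_simps)
      also have "\<dots> = (2 * c) powr p * ?m powr p"
        using \<open>0 \<le> c\<close> by (intro powr_mult)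
      also have "\<dots> \<le> (2 * c) powr p * (norm (A w) powr p + norm (B w) powr p)"
        by (intro mult_left_mono) (auto simp: max_def)
      finally show "norm (norm (Z w) powr p)
        \<le> norm ((2 * c) powr p * (norm (A w) powr p + norm (B w) powr p))"
        by simp
    qed
  qed measurable
  then show ?thesis
    by (simp add: Lp_space_def)
qed

lemma Lp_space_distr_cong:
  fixes X Y :: "'w \<Rightarrow> 'a::euclidean_space"
  assumes "X \<in> Lp_space M p" and [measurable]: "Y \<in> borel_measurable M"
    and eq: "distr M borel X = distr M borel Y"
  shows "Y \<in> Lp_space M p"
proof -
  have iff: "integrable M (\<lambda>w. norm (X w) powr p) \<longleftrightarrow> integrable (distr M borel X) (\<lambda>x. norm x powr p)"
    if "X \<in> borel_measurable M" for X :: "'w \<Rightarrow> 'a"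
    using that by (intro integrable_distr_eq[symmetric]) auto
  show ?thesis
    using assms(1) iff[of X] iff[of Y] eq by (simp add: Lp_space_def)
qed

lemma bregman_wasserstein_le:
  assumes "X \<in> borel_measurable M" "Y \<in> borel_measurable M"
    and "distr M borel X = F" "distr M borel Y = G"
  shows "bregman_wasserstein M \<Phi> F G \<le> (\<integral>\<^sup>+ w. ennreal (bregman_div \<Phi> (X w) (Y w)) \<partial>M)"
  unfolding bregman_wasserstein_def using assms by (intro INF_lower2[of "(X, Y)"]) auto

lemma bregman_wasserstein_ge:
  assumes "\<And>X Y. X \<in> borel_measurable M \<Longrightarrow> Y \<in> borel_measurable M \<Longrightarrow>
      distr M borel X = F \<Longrightarrow> distr M borel Y = G \<Longrightarrow>
      c \<le> (\<integral>\<^sup>+ w. ennreal (bregman_div \<Phi> (X w) (Y w)) \<partial>M)"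
  shows "c \<le> bregman_wasserstein M \<Phi> F G"
  unfolding bregman_wasserstein_def using assms by (intro INF_greatest) auto

section \<open>Diagonal quadratic forms and shifts along \<open>\<beta>\<close>\<close>

lemma diagonal_matrix_mult_nth:
  fixes Q :: "real ^ 'n ^ 'n"
  assumes "diagonal_matrix Q"
  shows "(Q *v v) $ i = Q $ i $ i * v $ i"
proof -
  have "(Q *v v) $ i = (\<Sum>j\<in>UNIV. Q $ i $ j * v $ j)"
    by (simp add: matrix_vector_mult_def)
  also have "\<dots> = (\<Sum>j\<in>UNIV. if j = i then Q $ i $ i * v $ i else 0)"
    using assms by (intro sum.cong) (auto simp: diagonal_matrix_def)
  finally show ?thesis
    by simp
qed

text \<open>Exhibits the spectrum as a finite non-empty set, on which \<open>Min\<close> and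
  \<open>Max\<close> are genuine extrema.\<close>

lemma eigenvalues_diagonal:
  fixes Q :: "real ^ 'n ^ 'n"
  assumes "diagonal_matrix Q"
  shows "eigenvalues Q = range (\<lambda>i. Q $ i $ i)"
proof (intro equalityI subsetI)
  fix c assume "c \<in> eigenvalues Q"
  then obtain v where v: "v \<noteq> 0" "Q *v v = c *\<^sub>R v"
    by (auto simp: eigenvalues_def)
  then obtain i where "v $ i \<noteq> 0"
    by (auto simp: vec_eq_iff)
  moreover have "Q $ i $ i * v $ i = c * v $ i"
    by (metis diagonal_matrix_mult_nth[OF assms] v(2) vector_scaleR_component real_scaleR_def)
  ultimately show "c \<in> range (\<lambda>i. Q $ i $ i)"
    by auto
next
  fix c assume "c \<in> range (\<lambda>i. Q $ i $ i)"
  then obtain i where "c = Q $ i $ i"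
    by blast
  then have "Q *v axis i 1 = c *\<^sub>R axis i 1"
    by (auto simp: vec_eq_iff diagonal_matrix_mult_nth[OF assms] axis_def)
  then show "c \<in> eigenvalues Q"
    unfolding eigenvalues_def by (auto simp: axis_eq_0_iff intro!: exI[of _ "axis i 1"])
qed

lemma quadratic_form_diagonal:
  fixes Q :: "real ^ 'n ^ 'n"
  assumes "diagonal_matrix Q"
  shows "x \<bullet> (Q *v x) = (\<Sum>i\<in>UNIV. Q $ i $ i * (x $ i)\<^sup>2)"
  by (simp add: inner_vec_def diagonal_matrix_mult_nth[OF assms] power2_eq_square ac_simps)

lemma quadratic_form_diagonal_bounds:
  fixes Q :: "real ^ 'n ^ 'n"
  assumes "diagonal_matrix Q"
  shows "Min (eigenvalues Q) * (norm x)\<^sup>2 \<le> x \<bullet> (Q *v x)"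
    and "x \<bullet> (Q *v x) \<le> Max (eigenvalues Q) * (norm x)\<^sup>2"
proof -
  have "(norm x)\<^sup>2 = (\<Sum>i\<in>UNIV. (x $ i)\<^sup>2)"
    unfolding power2_norm_eq_inner inner_vec_def by (simp add: power2_eq_square)
  then show "Min (eigenvalues Q) * (norm x)\<^sup>2 \<le> x \<bullet> (Q *v x)"
    "x \<bullet> (Q *v x) \<le> Max (eigenvalues Q) * (norm x)\<^sup>2"
    by (auto simp: quadratic_form_diagonal[OF assms] eigenvalues_diagonal[OF assms] sum_distrib_left
        intro!: sum_mono mult_right_mono)
qed

lemma diagonal_psd_eigenvalue_bounds:
  fixes Q :: "real ^ 'n ^ 'n"
  assumes "diagonal_matrix Q" "positive_semidefinite Q"
  shows "0 \<le> Min (eigenvalues Q)"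
    and "\<exists>i j. Q $ i $ j \<noteq> 0 \<Longrightarrow> 0 < Max (eigenvalues Q)"
proof -
  have nonneg: "0 \<le> Q $ i $ i" for i
  proof -
    have "0 \<le> axis i 1 \<bullet> (Q *v axis i 1)"
      using assms(2) by (simp add: positive_semidefinite_def)
    then show ?thesis
      by (simp add: inner_axis' diagonal_matrix_mult_nth[OF assms(1)])
  qed
  then show "0 \<le> Min (eigenvalues Q)"
    by (auto simp: eigenvalues_diagonal[OF assms(1)])
  assume "\<exists>i j. Q $ i $ j \<noteq> 0"
  then obtain i where "Q $ i $ i \<noteq> 0"
    using assms(1) by (metis diagonal_matrix_def)
  then have "0 < Q $ i $ i"
    using nonneg[of i] by simp
  also have "\<dots> \<le> Max (eigenvalues Q)"
    by (auto simp: eigenvalues_diagonal[OF assms(1)])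
  finally show "0 < Max (eigenvalues Q)" .
qed

text \<open>\<open>\<beta>\<close> is supported off \<open>I\<close>, so the shift leaves the
  argument of \<open>gt\<close> fixed and only the linear part changes. For
  \<open>\<beta> \<noteq> 0\<close>, \<open>g\<close> thus attains any prescribed value along the
  line through \<open>x\<close>.\<close>

lemma decomposition_shift:
  assumes "has_decomposition g I gt \<beta>"
  shows "g (x + c *\<^sub>R \<beta>) = g x + c * (norm \<beta>)\<^sup>2"
proof -
  have \<beta>: "\<beta> $ i = 0" if "i \<in> I" for i
    using assms that by (auto simp: has_decomposition_def coord_subspace_def)
  have 1: "coord_proj I (x + c *\<^sub>R \<beta>) = coord_proj I x"
    using \<beta> by (simp add: coord_proj_def vec_eq_iff)
  have 2: "coord_proj (- I) (x + c *\<^sub>R \<beta>) = coord_proj (- I) x + c *\<^sub>R \<beta>"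
    using \<beta> by (simp add: coord_proj_def vec_eq_iff)
  have "g y = gt (coord_proj I y) + \<beta> \<bullet> coord_proj (- I) y" for y
    using assms by (simp add: has_decomposition_def)
  then show ?thesis
    by (simp only: 1 2) (simp add: inner_add_right power2_norm_eq_inner)
qed

section \<open>Pushing uncertainty sets forward by \<open>g\<close>, and lifting them back along
  \<open>\<beta>\<close>\<close>

lemma lipschitz_bw_uncertainty_set:
  fixes M :: "'w measure" and g :: "real ^ 'n \<Rightarrow> real" and Q :: "real ^ 'n ^ 'n"
  assumes "prob_space M" "0 \<le> p" "0 < K" and g: "K-lipschitz_on UNIV g"
    and X: "X \<in> borel_measurable M"
    and Q: "diagonal_matrix Q" "positive_semidefinite Q"
    and Y: "Y \<in> bw_uncertainty_set M p (\<lambda>x. x \<bullet> (Q *v x)) \<epsilon> X"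
  shows "(\<lambda>w. g (Y w)) \<in> bw_uncertainty_set M p (\<lambda>x. Min (eigenvalues Q) * x\<^sup>2)
    (K\<^sup>2 * \<epsilon>) (\<lambda>w. g (X w))"
proof -
  interpret prob_space M by fact
  let ?l = "Min (eigenvalues Q)"
  have Q_sym: "transpose Q = Q"
    using Q(2) by (simp add: positive_semidefinite_def)
  have [measurable]: "g \<in> borel_measurable borel"
    using g by (intro borel_measurable_continuous_onI lipschitz_on_continuous_on)
  have quad_meas: "(\<lambda>x. x \<bullet> (Q *v x)) \<in> borel_measurable borel"
    by (intro borel_measurable_continuous_onI continuous_intros)
  have [measurable]: "X \<in> borel_measurable M" "Y \<in> borel_measurable M"
    and Y_Lp: "Y \<in> Lp_space M p"
    using X Y by (auto simp: bw_uncertainty_set_def Lp_space_def)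
  have "(\<lambda>w. g (Y w)) \<in> Lp_space M p"
  proof (rule Lp_spaceI_bound[where A = "\<lambda>_. 1 :: real" and B = Y and c = "\<bar>g 0\<bar> + K"])
    fix w
    have "\<bar>g (Y w) - g 0\<bar> \<le> K * norm (Y w)"
      using lipschitz_onD[OF g, of "Y w" 0] by (simp add: dist_norm)
    then have "\<bar>g (Y w)\<bar> \<le> \<bar>g 0\<bar> + K * norm (Y w)"
      by linarith
    also have "\<dots> \<le> (\<bar>g 0\<bar> + K) * (1 + norm (Y w))"
      using \<open>0 < K\<close> by (simp add: algebra_simps)
    finally show "norm (g (Y w)) \<le> (\<bar>g 0\<bar> + K) * (norm (1 :: real) + norm (Y w))"
      by simp
  qed (use Y_Lp \<open>0 \<le> p\<close> \<open>0 < K\<close> in \<open>auto simp: Lp_space_def\<close>)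
  moreover have "bregman_wasserstein M (\<lambda>x. ?l * x\<^sup>2)
      (distr M borel (\<lambda>w. g (Y w))) (distr M borel (\<lambda>w. g (X w))) \<le> ennreal (K\<^sup>2) *
      bregman_wasserstein M (\<lambda>x. x \<bullet> (Q *v x)) (distr M borel Y) (distr M borel X)"
    (is "?B \<le> _")
  proof -
    have pointwise: "?l * (g x - g y)\<^sup>2 \<le> K\<^sup>2 * ((x - y) \<bullet> (Q *v (x - y)))" for x y
    proof -
      have "\<bar>g x - g y\<bar> \<le> K * norm (x - y)"
        using lipschitz_onD[OF g, of x y] by (simp add: dist_norm)
      then have "(g x - g y)\<^sup>2 \<le> (K * norm (x - y))\<^sup>2"
        by (metis abs_ge_zero power2_abs power_mono)
      then have "?l * (g x - g y)\<^sup>2 \<le> ?l * (K * norm (x - y))\<^sup>2"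
        by (intro mult_left_mono diagonal_psd_eigenvalue_bounds Q)
      also have "\<dots> = K\<^sup>2 * (?l * (norm (x - y))\<^sup>2)"
        by (simp add: power_mult_distrib)
      also have "\<dots> \<le> K\<^sup>2 * ((x - y) \<bullet> (Q *v (x - y)))"
        by (intro mult_left_mono quadratic_form_diagonal_bounds Q) simp
      finally show ?thesis .
    qed
    \<comment> \<open>Dividing by \<open>K\<^sup>2\<close> leaves the bare infimum on the right, so
      that it suffices to bound each coupling of \<open>Y\<close> and \<open>X\<close>
      separately.\<close>
    have "?B / ennreal (K\<^sup>2)
        \<le> bregman_wasserstein M (\<lambda>x. x \<bullet> (Q *v x)) (distr M borel Y) (distr M borel X)"
    proof (rule bregman_wasserstein_ge)
      fix Y' X' assume [measurable]: "Y' \<in> borel_measurable M" "X' \<in> borel_measurable M"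
        and eq: "distr M borel Y' = distr M borel Y" "distr M borel X' = distr M borel X"
      have g_distr: "distr M borel (\<lambda>w. g (Z w)) = distr (distr M borel Z) borel g"
        if [measurable]: "Z \<in> borel_measurable M" for Z
        by (subst distr_distr) (auto simp: comp_def)
      have "?B \<le> (\<integral>\<^sup>+ w. ennreal (bregman_div (\<lambda>x. ?l * x\<^sup>2) (g (Y' w)) (g (X' w))) \<partial>M)"
        by (rule bregman_wasserstein_le) (simp_all add: g_distr eq)
      also have "\<dots> \<le> (\<integral>\<^sup>+ w. ennreal (K\<^sup>2) *
          ennreal (bregman_div (\<lambda>x. x \<bullet> (Q *v x)) (Y' w) (X' w)) \<partial>M)"
        using pointwise Q(2)
        by (intro nn_integral_mono)
          (simp add: bregman_div_square bregman_div_quadratic_form positive_semidefinite_def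
            ennreal_mult[symmetric])
      also have "\<dots> = ennreal (K\<^sup>2) *
          (\<integral>\<^sup>+ w. ennreal (bregman_div (\<lambda>x. x \<bullet> (Q *v x)) (Y' w) (X' w)) \<partial>M)"
        unfolding bregman_div_quadratic_form[OF Q_sym]
        by (intro nn_integral_cmult measurable_compose[OF _ measurable_ennreal]
            measurable_compose[OF _ quad_meas]) measurable
      finally show "?B / ennreal (K\<^sup>2) \<le>
          (\<integral>\<^sup>+ w. ennreal (bregman_div (\<lambda>x. x \<bullet> (Q *v x)) (Y' w) (X' w)) \<partial>M)"
        using \<open>0 < K\<close> by (intro divide_le_posI_ennreal) simp_all
    qed
    then have "ennreal (K\<^sup>2) * (?B / ennreal (K\<^sup>2)) \<le> ennreal (K\<^sup>2) *
        bregman_wasserstein M (\<lambda>x. x \<bullet> (Q *v x)) (distr M borel Y) (distr M borel X)"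
      by (rule mult_left_mono) simp
    then show ?thesis
      using \<open>0 < K\<close> by (simp add: ennreal_times_divide mult_divide_eq_ennreal mult.commute[of _ ?B])
  qed
  moreover have "\<dots> \<le> ennreal (K\<^sup>2) * ennreal \<epsilon>"
    using Y by (intro mult_left_mono) (auto simp: bw_uncertainty_set_def)
  ultimately show ?thesis
    by (simp add: bw_uncertainty_set_def ennreal_mult')
qed

text \<open>The conclusion gives \<open>g Z\<close> the law of \<open>Y\<close> rather than its
  values: \<open>Y\<close> itself need not be optimally coupled to \<open>g X\<close>, so a copy
  \<open>Y'\<close> of the same law takes its place. For a law-invariant functional this is
  enough.\<close>

lemma bw_uncertainty_set_shift:
  fixes M :: "(real ^ 'n) measure" and g :: "real ^ 'n \<Rightarrow> real" and Q :: "real ^ 'n ^ 'n"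
  assumes "prob_space M" and sets_M: "sets M = sets borel" and "nonatomic M" and "0 \<le> p"
    and decomp: "has_decomposition g I gt \<beta>"
    and X: "X \<in> Lp_space M p" and G: "(\<lambda>w. g (X w)) \<in> Lp_space M p"
    and Q: "diagonal_matrix Q" "positive_semidefinite Q" "\<exists>i j. Q $ i $ j \<noteq> 0"
    and Y: "Y \<in> bw_uncertainty_set M p (\<lambda>x. Max (eigenvalues Q) * x\<^sup>2)
      ((norm \<beta>)\<^sup>2 * \<epsilon>) (\<lambda>w. g (X w))"
    and "0 \<le> \<epsilon>"
  shows "\<exists>Z \<in> bw_uncertainty_set M p (\<lambda>x. x \<bullet> (Q *v x)) \<epsilon> X.
    (\<lambda>w. g (Z w)) \<in> Lp_space M p \<and> distr M borel (\<lambda>w. g (Z w)) = distr M borel Y"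
proof -
  interpret prob_space M by fact
  let ?l = "Max (eigenvalues Q)"
  let ?G = "\<lambda>w. g (X w)"
  have "0 < ?l"
    using Q by (intro diagonal_psd_eigenvalue_bounds)
  have [measurable]: "X \<in> borel_measurable M" "Y \<in> borel_measurable M" and Y_Lp: "Y \<in> Lp_space M p"
    and G_meas[measurable]: "?G \<in> borel_measurable M"
    using X Y G by (auto simp: bw_uncertainty_set_def Lp_space_def)
  obtain V :: "real ^ 'n \<Rightarrow> real" where "V \<in> borel_measurable borel" and "inj V"
    and V01: "\<And>x. 0 \<le> V x \<and> V x \<le> 1"
    using ex_injective_borel_real by blast
  then have V[measurable]: "V \<in> borel_measurable M"
    by (simp add: measurable_cong_sets[OF sets_M refl])
  \<comment> \<open>Level sets of the injective \<open>V\<close> have at most one point.\<close>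
  have V_atomless: "prob {w \<in> space M. V w = v} = 0" for v
  proof (cases "\<exists>w. V w = v")
    case True
    then obtain w0 where "V w0 = v"
      by blast
    then have "{w \<in> space M. V w = v} \<subseteq> {w0}"
      using \<open>inj V\<close> by (auto dest: injD)
    moreover have "{w0} \<in> sets M"
      by (simp add: sets_M)
    ultimately have "prob {w \<in> space M. V w = v} \<le> prob {w0}"
      by (intro finite_measure_mono)
    also have "prob {w0} = 0"
      using nonatomic_singleton_null[OF \<open>nonatomic M\<close> \<open>{w0} \<in> sets M\<close>] by (simp add: measure_def)
    finally show ?thesis
      by (simp add: measure_le_0_iff)
  qed auto
  obtain Y' where [measurable]: "Y' \<in> borel_measurable M"
    and Y'_distr: "distr M borel Y' = distr M borel Y"
    and optimal: "\<And>Y'' X''. Y'' \<in> borel_measurable M \<Longrightarrow> X'' \<in> borel_measurable M \<Longrightarrow>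
      distr M borel Y'' = distr M borel Y \<Longrightarrow> distr M borel X'' = distr M borel ?G \<Longrightarrow>
      (\<integral>\<^sup>+ w. ennreal ((Y' w - ?G w)\<^sup>2) \<partial>M) \<le> (\<integral>\<^sup>+ w. ennreal ((Y'' w - X'' w)\<^sup>2) \<partial>M)"
  proof -
    have "V \<in> space M \<rightarrow> {0..1}"
      using V01 by auto
    from ex_optimal_quadratic_coupling[OF G_meas V this V_atomless, of "distr M borel Y"] that
    show thesis
      by auto
  qed
  have Y'_Lp: "Y' \<in> Lp_space M p"
    by (rule Lp_space_distr_cong[OF Y_Lp]) (simp_all add: Y'_distr)
  \<comment> \<open>\<open>Y'\<close> does at least as well against \<open>g X\<close> as any
    coupling, hence as the infimum that the uncertainty set bounds.\<close>
  have cost: "(\<integral>\<^sup>+ w. ennreal (?l * (Y' w - ?G w)\<^sup>2) \<partial>M) \<le> ennreal ((norm \<beta>)\<^sup>2 * \<epsilon>)"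
  proof -
    have scale: "(\<integral>\<^sup>+ w. ennreal (?l * (A w)\<^sup>2) \<partial>M) = ennreal ?l * (\<integral>\<^sup>+ w. ennreal ((A w)\<^sup>2) \<partial>M)"
      if [measurable]: "A \<in> borel_measurable M" for A
      using \<open>0 < ?l\<close> by (simp add: ennreal_mult nn_integral_cmult)
    have "(\<integral>\<^sup>+ w. ennreal (?l * (Y' w - ?G w)\<^sup>2) \<partial>M) \<le>
        bregman_wasserstein M (\<lambda>x. ?l * x\<^sup>2) (distr M borel Y) (distr M borel ?G)"
    proof (rule bregman_wasserstein_ge)
      fix Y'' X'' assume [measurable]: "Y'' \<in> borel_measurable M" "X'' \<in> borel_measurable M"
        and "distr M borel Y'' = distr M borel Y" "distr M borel X'' = distr M borel ?G"
      then show "(\<integral>\<^sup>+ w. ennreal (?l * (Y' w - ?G w)\<^sup>2) \<partial>M) \<le>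
          (\<integral>\<^sup>+ w. ennreal (bregman_div (\<lambda>x. ?l * x\<^sup>2) (Y'' w) (X'' w)) \<partial>M)"
        by (simp add: bregman_div_square scale mult_left_mono optimal)
    qed
    also have "\<dots> \<le> ennreal ((norm \<beta>)\<^sup>2 * \<epsilon>)"
      using Y by (simp add: bw_uncertainty_set_def)
    finally show ?thesis .
  qed
  txt \<open>For \<open>\<beta> = 0\<close> the quotient is \<open>0\<close> and hence \<open>Z = X\<close>; then \<open>Y' = g X\<close> almost surely, because the
    cost is \<open>0\<close>.\<close>
  define Z where "Z w = X w + ((Y' w - ?G w) / (norm \<beta>)\<^sup>2) *\<^sub>R \<beta>" for w
  have [measurable]: "Z \<in> borel_measurable M"
    unfolding Z_def by measurable
  have gZ: "AE w in M. g (Z w) = Y' w"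
  proof (cases "\<beta> = 0")
    case True
    then have "(\<integral>\<^sup>+ w. ennreal (?l * (Y' w - ?G w)\<^sup>2) \<partial>M) = 0"
      using cost by simp
    then have "AE w in M. ennreal (?l * (Y' w - ?G w)\<^sup>2) = 0"
      by (subst (asm) nn_integral_0_iff_AE) auto
    then show ?thesis
    proof eventually_elim
      case (elim w)
      then have "?l * (Y' w - ?G w)\<^sup>2 \<le> 0"
        by (simp add: ennreal_eq_0_iff)
      then show ?case
        using \<open>0 < ?l\<close> True by (simp add: Z_def mult_le_0_iff)
    qed
  next
    case False
    then show ?thesis
      by (simp add: Z_def decomposition_shift[OF decomp])
  qed
  \<comment> \<open>The shift formula writes \<open>g (Z w)\<close> through \<open>g (X w)\<close>
    and \<open>Y' w\<close>, also for \<open>\<beta> = 0\<close>.\<close>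
  have gZ_meas[measurable]: "(\<lambda>w. g (Z w)) \<in> borel_measurable M"
    unfolding Z_def decomposition_shift[OF decomp] by measurable
  have gZ_distr: "distr M borel (\<lambda>w. g (Z w)) = distr M borel Y"
    unfolding Y'_distr[symmetric] using gZ by (intro distr_cong_AE) auto
  have Z_Lp: "Z \<in> Lp_space M p"
  proof (rule Lp_spaceI_bound[OF _ X])
    show "(\<lambda>w. Y' w - ?G w) \<in> Lp_space M p"
      by (rule Lp_spaceI_bound[OF _ Y'_Lp G, of _ 1]) (use \<open>0 \<le> p\<close> in auto)
    \<comment> \<open>The quotient is \<open>1 / norm \<beta>\<close>, and 0 for
      \<open>\<beta> = 0\<close> by the convention for division.\<close>
    show "norm (Z w) \<le> (1 + norm \<beta> / (norm \<beta>)\<^sup>2) * (norm (X w) + norm (Y' w - ?G w))" for w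
    proof -
      have "norm (Z w) \<le> norm (X w) + norm \<beta> / (norm \<beta>)\<^sup>2 * \<bar>Y' w - ?G w\<bar>"
        unfolding Z_def by (rule order_trans[OF norm_triangle_ineq]) (simp add: mult.commute)
      also have "\<dots> \<le> (1 + norm \<beta> / (norm \<beta>)\<^sup>2) * (norm (X w) + norm (Y' w - ?G w))"
        by (simp add: distrib_left distrib_right)
      finally show ?thesis .
    qed
  qed (use \<open>0 \<le> p\<close> in auto)
  have "bregman_wasserstein M (\<lambda>x. x \<bullet> (Q *v x)) (distr M borel Z) (distr M borel X)
      \<le> (\<integral>\<^sup>+ w. ennreal (bregman_div (\<lambda>x. x \<bullet> (Q *v x)) (Z w) (X w)) \<partial>M)"
    by (rule bregman_wasserstein_le) auto
  also have "\<dots> \<le> ennreal \<epsilon>"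
  proof (cases "\<beta> = 0")
    case True
    then show ?thesis
      using Q(2) by (simp add: bregman_div_quadratic_form positive_semidefinite_def Z_def)
  next
    case False
    have "(\<integral>\<^sup>+ w. ennreal (bregman_div (\<lambda>x. x \<bullet> (Q *v x)) (Z w) (X w)) \<partial>M)
        \<le> (\<integral>\<^sup>+ w. ennreal (1 / (norm \<beta>)\<^sup>2) * ennreal (?l * (Y' w - ?G w)\<^sup>2) \<partial>M)"
    proof (intro nn_integral_mono)
      fix w
      have "bregman_div (\<lambda>x. x \<bullet> (Q *v x)) (Z w) (X w) = (Z w - X w) \<bullet> (Q *v (Z w - X w))"
        using Q(2) by (simp add: bregman_div_quadratic_form positive_semidefinite_def)
      also have "\<dots> \<le> ?l * (norm (Z w - X w))\<^sup>2"
        by (rule quadratic_form_diagonal_bounds(2)[OF Q(1)])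
      \<comment> \<open>The step \<open>Z - X\<close> has length
        \<open>\<bar>Y' - g X\<bar> / norm \<beta>\<close>; the resulting factor cancels the one in
        the radius \<open>(norm \<beta>)\<^sup>2 * \<epsilon>\<close>.\<close>
      also have "\<dots> = 1 / (norm \<beta>)\<^sup>2 * (?l * (Y' w - ?G w)\<^sup>2)"
        using False by (simp add: Z_def power_mult_distrib power_divide field_simps power2_eq_square)
      finally show "ennreal (bregman_div (\<lambda>x. x \<bullet> (Q *v x)) (Z w) (X w)) \<le>
          ennreal (1 / (norm \<beta>)\<^sup>2) * ennreal (?l * (Y' w - ?G w)\<^sup>2)"
        using \<open>0 < ?l\<close> by (subst ennreal_mult[symmetric]) (auto intro: ennreal_leI)
    qed
    also have "\<dots> = ennreal (1 / (norm \<beta>)\<^sup>2) * (\<integral>\<^sup>+ w. ennreal (?l * (Y' w - ?G w)\<^sup>2) \<partial>M)"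
      by (intro nn_integral_cmult) measurable
    also have "\<dots> \<le> ennreal (1 / (norm \<beta>)\<^sup>2) * ennreal ((norm \<beta>)\<^sup>2 * \<epsilon>)"
      by (intro mult_left_mono cost) simp
    also have "\<dots> = ennreal \<epsilon>"
      using False \<open>0 \<le> \<epsilon>\<close> by (subst ennreal_mult[symmetric]) auto
    finally show ?thesis .
  qed
  finally have "Z \<in> bw_uncertainty_set M p (\<lambda>x. x \<bullet> (Q *v x)) \<epsilon> X"
    using Z_Lp by (simp add: bw_uncertainty_set_def)
  then show ?thesis
    using gZ_distr Lp_space_distr_cong[OF Y_Lp gZ_meas] by metis
qed

text \<open>Suprema are taken in \<open>ereal\<close>, as they may be infinite. Both inequalities
  hold term by term: each value on the left occurs among the values on the right.\<close>

theorem corollary3: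
  fixes M :: "(real ^ 'n) measure"
    and p K \<epsilon> :: real
    and g gt :: "real ^ 'n \<Rightarrow> real"
    and I :: "'n set"
    and \<beta> :: "real ^ 'n"
    and X :: "real ^ 'n \<Rightarrow> real ^ 'n"
    and Q :: "real ^ 'n ^ 'n"
    and \<rho> :: "(real ^ 'n \<Rightarrow> real) \<Rightarrow> real"
  assumes "prob_space M" and "sets M = sets borel" and "nonatomic M"
    and "1 \<le> p"
    and "K-lipschitz_on UNIV g"
    and "\<not> g constant_on UNIV"
    and "has_decomposition g I gt \<beta>"
    and "X \<in> Lp_space M p"
    and "(\<lambda>w. g (X w)) \<in> Lp_space M p"
    and "diagonal_matrix Q" and "positive_semidefinite Q" and "\<exists>i j. Q $ i $ j \<noteq> 0"
    and "0 \<le> \<epsilon>"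
    and "law_invariant M p \<rho>"
  shows "(SUP Y \<in> bw_uncertainty_set M p (\<lambda>x::real. Max (eigenvalues Q) * x\<^sup>2)
                    ((norm \<beta>)\<^sup>2 * \<epsilon>) (\<lambda>w. g (X w)). ereal (\<rho> Y))
         \<le> (SUP Y \<in> bw_uncertainty_set M p (\<lambda>x. x \<bullet> (Q *v x)) \<epsilon> X.
              ereal (\<rho> (\<lambda>w. g (Y w))))
       \<and> (SUP Y \<in> bw_uncertainty_set M p (\<lambda>x. x \<bullet> (Q *v x)) \<epsilon> X.
              ereal (\<rho> (\<lambda>w. g (Y w))))
         \<le> (SUP Y \<in> bw_uncertainty_set M p (\<lambda>x::real. Min (eigenvalues Q) * x\<^sup>2)
                    (K\<^sup>2 * \<epsilon>) (\<lambda>w. g (X w)). ereal (\<rho> Y))"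
proof (intro conjI SUP_least)
  have "0 \<le> p"
    using \<open>1 \<le> p\<close> by simp
  {
    fix Y assume Y: "Y \<in> bw_uncertainty_set M p (\<lambda>x. Max (eigenvalues Q) * x\<^sup>2)
      ((norm \<beta>)\<^sup>2 * \<epsilon>) (\<lambda>w. g (X w))"
    obtain Z where Z: "Z \<in> bw_uncertainty_set M p (\<lambda>x. x \<bullet> (Q *v x)) \<epsilon> X"
      "(\<lambda>w. g (Z w)) \<in> Lp_space M p" "distr M borel (\<lambda>w. g (Z w)) = distr M borel Y"
      using bw_uncertainty_set_shift[OF assms(1-3) \<open>0 \<le> p\<close> assms(7-12) Y assms(13)] by blast
    have "Y \<in> Lp_space M p"
      using Y by (simp add: bw_uncertainty_set_def)
    then have "\<rho> Y = \<rho> (\<lambda>w. g (Z w))"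
      using \<open>law_invariant M p \<rho>\<close> Z(2) Z(3)[symmetric] unfolding law_invariant_def by blast
    then show "ereal (\<rho> Y) \<le> (SUP Y \<in> bw_uncertainty_set M p (\<lambda>x. x \<bullet> (Q *v x)) \<epsilon> X.
        ereal (\<rho> (\<lambda>w. g (Y w))))"
      using Z(1) by (intro SUP_upper2) auto
  next
    fix Y assume Y: "Y \<in> bw_uncertainty_set M p (\<lambda>x. x \<bullet> (Q *v x)) \<epsilon> X"
    \<comment> \<open>Positivity of \<open>K\<close> permits the division by
      \<open>K\<^sup>2\<close> in the comparison of infima.\<close>
    have "K \<noteq> 0"
    proof
      assume "K = 0"
      then have "g x = g 0" for x
        using lipschitz_onD[OF assms(5), of x 0] by simp
      then show False
        using \<open>\<not> g constant_on UNIV\<close> by (auto simp: constant_on_def)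
    qed
    then have "0 < K"
      using lipschitz_on_nonneg[OF assms(5)] by simp
    moreover have "X \<in> borel_measurable M"
      using \<open>X \<in> Lp_space M p\<close> by (simp add: Lp_space_def)
    ultimately show "ereal (\<rho> (\<lambda>w. g (Y w))) \<le>
        (SUP Y \<in> bw_uncertainty_set M p (\<lambda>x. Min (eigenvalues Q) * x\<^sup>2)
                    (K\<^sup>2 * \<epsilon>) (\<lambda>w. g (X w)). ereal (\<rho> Y))"
      by (intro SUP_upper lipschitz_bw_uncertainty_set assms \<open>0 \<le> p\<close> Y)
  }
qed

end
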